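(* Let $\mathfrak W=\{w_k\}_{k\ge0}$ be a system of continuous complex-valued functions on $\mathbb T$ satisfying the assumptions (A), (B) and (1)--(4) of the context, let $\mathbf X$ be a varying Gaussian process w.r.t. $\mathfrak W$ with spectral measure $\sigma$, and let $\Phi_n,\Phi_n^*$ be the monic generalized orthogonal polynomial and the monic generalized reversed orthogonal polynomial w.r.t. $\mathfrak W$ and $\sigma$. Let $\hat X_n$ be the orthogonal projection of $X_n$ onto $\mathrm{lin}\{X_0,\dots,X_{n-1}\}$ (forward prediction) and $\check X_0$ the orthogonal projection of $X_0$ onto $\mathrm{lin}\{X_1,\dots,X_n\}$ (backward prediction), both in $L^2(dP)$, and let $\hat E_n=X_n-\hat X_n$, $\check E_0=X_0-\check X_0$ be the corresponding innovations. Then $$\hat X_n=(\mathcal Z^n-\Phi_n(\mathcal Z))X_0,\qquad \hat E_n=\Phi_n(\mathcal Z)X_0,$$ $$\check X_0=(I-\Phi_n^*(\mathcal Z))X_0,\qquad \check E_0=\Phi_n^*(\mathcal Z)X_0 .$$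
   Context: $\mathbb T=\{z\in\mathbb C:|z|=1\}$, and $\mathcal M(\mathbb T)$ is the set of positive finite Borel measures on $\mathbb T$. For a system $\mathfrak W=\{w_k\}_{k\ge0}$ of continuous functions $w_k:\mathbb T\to\mathbb C$ put $w_{-k}=\overline{w_k}$, let $\mathcal L_n$ be the complex linear span of $w_0,\dots,w_n$, and $\overline{\mathcal L}_n=\{\overline f:f\in\mathcal L_n\}$. Assumptions on $\mathfrak W$: (A) The functions $w_k$, $k\in\mathbb Z$, are linearly independent over $\mathbb C$ on $\mathbb T$. (B) $\sum_{k=0}^n(a_kw_k+\overline{a_kw_k})>0$ on $\mathbb T$ for some coefficients $a_k\in\mathbb C$. (1) $w_0=1$. (2) $\overline{w_j}w_k\in\overline{\mathcal L}_j+\mathcal L_k$ for $j,k\ge0$, i.e. $\overline{w_j}w_k=\sum_{s=-j}^k\beta_{jk,s}w_s$ with some coefficients $\beta_{jk,s}$. (3) If $\sum_{k=0}^n(a_kw_k+\overline{a_kw_k})\ge0$ on $\mathbb T$, then it equals $\left|\sum_{k=0}^n b_kw_k\right|^2$ for some $b_0,\dots,b_n\in\mathbb C$. (4) (Separation) If $\mu\in\mathcal M(\mathbb T)$ and $\int_{\mathbb T}w_k\,d\mu=0$ for all $k$, then $\mu=0$. A varying Gaussian process w.r.t. $\mathfrak W$ is a family $\mathbf X=\{X_n\}$ of jointly normally distributed complex random variables on a probability space $(\Omega,\mathcal F,P)$, with $E(X_n)=0$ and $E(|X_n|^2)<\infty$, whose covariances $c_{jk}=E(X_k\overline{X_j})$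 form generalized Toeplitz matrices w.r.t. $\mathfrak W$: the matrices are Hermitian nonnegative and $c_{jk}=\sum_{s=-j}^k\beta_{jk,s}c_s$, where $c_s=c_{0s}$, $c_{-s}=\overline{c_s}$ for $s\ge0$. Its spectral measure is the unique $\sigma\in\mathcal M(\mathbb T)$ such that $c_{jk}=\int_{\mathbb T}\overline{w_j}w_k\,d\sigma$ for all $j,k$. Since $\mathfrak W$ is linearly independent on $\mathbb T$, it is also linearly independent in $L^2(d\sigma)$, and the following are well defined. The generalized orthogonal polynomials $\varphi_k$, $\|\varphi_k\|_{L^2(d\sigma)}=1$, are obtained from $\{w_k\}$ by the Gram--Schmidt procedure in $L^2(d\sigma)$. The generalized reversed orthogonal polynomials $\varphi_k^*$ satisfy $\varphi_k^*\in\mathcal L_k$, $\|\varphi_k^*\|_{L^2(d\sigma)}=1$, $(\varphi_k^*,w_j)_{L^2(d\sigma)}=0$ for $j=1,\dots,k$; equivalently, $\varphi_k^*$ is the last element obtained by orthonormalizing $w_k,w_{k-1},\dots,w_0$. The monic versions $\Phi_k$, $\Phi_k^*$ are the multiples of $\varphi_k$, $\varphi_k^*$ whose coefficient at $w_k$, respectively at $w_0$, equals $1$. The shift $\mathcal Z$ acts by $\mathcal ZX_k=X_{k+1}$, so $X_k=\mathcal Z^kX_0$; for $f=\sum_{k=0}^na_kw_k$, $f(\mathcal Z)X_0$ means $\sum_{k=0}^na_k\mathcal Z^kX_0=\sum_{k=0}^na_kX_k$. *)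

theory Defs
  imports "HOL-Probability.Probability"
begin

subsection \<open>Square integrable functions\<close>

definition l2_inner :: "'a measure \<Rightarrow> ('a \<Rightarrow> complex) \<Rightarrow> ('a \<Rightarrow> complex) \<Rightarrow> complex" where
  "l2_inner M f g = (LINT x|M. f x * cnj (g x))"

definition l2_norm :: "'a measure \<Rightarrow> ('a \<Rightarrow> complex) \<Rightarrow> real" where
  "l2_norm M f = sqrt (LINT x|M. (cmod (f x))\<^sup>2)"

definition lin :: "('i \<Rightarrow> 'a \<Rightarrow> complex) \<Rightarrow> 'i set \<Rightarrow> ('a \<Rightarrow> complex) set" where
  "lin v J = {f. \<exists>a. f = (\<lambda>x. \<Sum>j\<in>J. a j * v j x)}"

text \<open>Elements of \<open>L\<^sup>2\<close> are represented by functions, so the projection below is one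
  representative of the class; statements about it are made up to null sets.\<close>

definition l2_proj :: "'a measure \<Rightarrow> ('a \<Rightarrow> complex) set \<Rightarrow> ('a \<Rightarrow> complex) \<Rightarrow> 'a \<Rightarrow> complex" where
  "l2_proj M V f = (SOME g. g \<in> V \<and> (\<forall>h\<in>V. l2_inner M (\<lambda>x. f x - g x) h = 0))"

text \<open>If \<open>v k\<close> depends linearly on \<open>v 0, \<dots>, v (k - 1)\<close> in \<open>L\<^sup>2(M)\<close>, the normalization
  divides by zero and yields the zero function. This keeps the procedure total when \<open>M\<close> is
  carried by finitely many points.\<close>

fun gram_schmidt :: "'a measure \<Rightarrow> (nat \<Rightarrow> 'a \<Rightarrow> complex) \<Rightarrow> nat \<Rightarrow> 'a \<Rightarrow> complex" where
  "gram_schmidt M v k =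
    (let r = (\<lambda>x. v k x - (\<Sum>j<k. l2_inner M (v k) (gram_schmidt M v j) * gram_schmidt M v j x))
     in (\<lambda>x. r x / of_real (l2_norm M r)))"

declare gram_schmidt.simps [simp del]


subsection \<open>Systems of functions on the unit circle\<close>

abbreviation circle :: "complex set" where
  "circle \<equiv> sphere 0 1"

definition circle_measures :: "complex measure set" where
  "circle_measures = {\<mu>. finite_measure \<mu> \<and> sets \<mu> = sets (restrict_space borel circle)}"

definition two_sided :: "(nat \<Rightarrow> complex \<Rightarrow> complex) \<Rightarrow> int \<Rightarrow> complex \<Rightarrow> complex" where
  "two_sided w s = (if s \<ge> 0 then w (nat s) else (\<lambda>z. cnj (w (nat (- s)) z)))"

text \<open>The coefficients of a function in the linear span of \<open>two_sided w\<close> on the circle; they are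
  unique if this system is linearly independent there.\<close>

definition coef :: "(nat \<Rightarrow> complex \<Rightarrow> complex) \<Rightarrow> (complex \<Rightarrow> complex) \<Rightarrow> int \<Rightarrow> complex" where
  "coef w f = (THE a. finite {s. a s \<noteq> 0} \<and>
     (\<forall>z\<in>circle. f z = (\<Sum>s | a s \<noteq> 0. a s * two_sided w s z)))"

definition real_part_sum :: "(nat \<Rightarrow> complex \<Rightarrow> complex) \<Rightarrow> nat \<Rightarrow> (nat \<Rightarrow> complex) \<Rightarrow> complex \<Rightarrow> real" where
  "real_part_sum w n a z = Re (\<Sum>k\<le>n. a k * w k z + cnj (a k * w k z))"

definition admissible_system :: "(nat \<Rightarrow> complex \<Rightarrow> complex) \<Rightarrow> bool" where
  "admissible_system w \<longleftrightarrow>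
     (\<forall>k. continuous_on circle (w k)) \<and>
     (\<forall>S a. finite S \<longrightarrow> (\<forall>z\<in>circle. (\<Sum>s\<in>S. a s * two_sided w s z) = 0) \<longrightarrow> (\<forall>s\<in>S. a s = 0)) \<and>
     (\<exists>n a. \<forall>z\<in>circle. real_part_sum w n a z > 0) \<and>
     (\<forall>z\<in>circle. w 0 z = 1) \<and>
     (\<forall>j k. \<exists>b. \<forall>z\<in>circle.
        cnj (w j z) * w k z = (\<Sum>s=- int j..int k. b s * two_sided w s z)) \<and>
     (\<forall>n a. (\<forall>z\<in>circle. real_part_sum w n a z \<ge> 0) \<longrightarrow>
        (\<exists>b. \<forall>z\<in>circle. real_part_sum w n a z = (cmod (\<Sum>k\<le>n. b k * w k z))\<^sup>2)) \<and>
     (\<forall>\<mu>\<in>circle_measures. (\<forall>k. (LINT z|\<mu>. w k z) = 0) \<longrightarrow> \<mu> = null_measure \<mu>)"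

definition structure_coef :: "(nat \<Rightarrow> complex \<Rightarrow> complex) \<Rightarrow> nat \<Rightarrow> nat \<Rightarrow> int \<Rightarrow> complex" where
  "structure_coef w j k = coef w (\<lambda>z. cnj (w j z) * w k z)"


subsection \<open>Generalized orthogonal polynomials\<close>

definition gop :: "(nat \<Rightarrow> complex \<Rightarrow> complex) \<Rightarrow> complex measure \<Rightarrow> nat \<Rightarrow> complex \<Rightarrow> complex" where
  "gop w \<sigma> k = gram_schmidt \<sigma> w k"

text \<open>The last element obtained by orthonormalizing \<open>w k, w (k - 1), \<dots>, w 0\<close>.\<close>

definition reversed_gop ::
  "(nat \<Rightarrow> complex \<Rightarrow> complex) \<Rightarrow> complex measure \<Rightarrow> nat \<Rightarrow> complex \<Rightarrow> complex" where
  "reversed_gop w \<sigma> k = gram_schmidt \<sigma> (\<lambda>j. w (k - j)) k"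

definition monic_gop ::
  "(nat \<Rightarrow> complex \<Rightarrow> complex) \<Rightarrow> complex measure \<Rightarrow> nat \<Rightarrow> complex \<Rightarrow> complex" where
  "monic_gop w \<sigma> k = (\<lambda>z. gop w \<sigma> k z / coef w (gop w \<sigma> k) (int k))"

definition monic_reversed_gop ::
  "(nat \<Rightarrow> complex \<Rightarrow> complex) \<Rightarrow> complex measure \<Rightarrow> nat \<Rightarrow> complex \<Rightarrow> complex" where
  "monic_reversed_gop w \<sigma> k = (\<lambda>z. reversed_gop w \<sigma> k z / coef w (reversed_gop w \<sigma> k) 0)"


subsection \<open>Varying Gaussian processes\<close>

text \<open>Constants count as normal variables (variance zero).\<close>

definition normal_rv :: "'a measure \<Rightarrow> ('a \<Rightarrow> real) \<Rightarrow> bool" where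
  "normal_rv P Y \<longleftrightarrow>
     (\<exists>m s. s > 0 \<and> distributed P lborel Y (normal_density m s)) \<or> (\<exists>m. AE \<omega> in P. Y \<omega> = m)"

text \<open>The functions \<open>\<lambda>\<omega>. Re (\<Sum>k\<le>n. a k * X k \<omega>)\<close> are exactly the real linear combinations of the
  real and imaginary parts of \<open>X 0, \<dots>, X n\<close>.\<close>

definition jointly_normal :: "'a measure \<Rightarrow> (nat \<Rightarrow> 'a \<Rightarrow> complex) \<Rightarrow> bool" where
  "jointly_normal P X \<longleftrightarrow> (\<forall>n a. normal_rv P (\<lambda>\<omega>. Re (\<Sum>k\<le>n. a k * X k \<omega>)))"

definition covariance :: "'a measure \<Rightarrow> (nat \<Rightarrow> 'a \<Rightarrow> complex) \<Rightarrow> nat \<Rightarrow> nat \<Rightarrow> complex" where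
  "covariance P X j k = l2_inner P (X k) (X j)"

definition generalized_toeplitz ::
  "(nat \<Rightarrow> complex \<Rightarrow> complex) \<Rightarrow> (nat \<Rightarrow> nat \<Rightarrow> complex) \<Rightarrow> bool" where
  "generalized_toeplitz w c \<longleftrightarrow>
     (\<forall>j k. c k j = cnj (c j k)) \<and>
     (\<forall>n x. Re (\<Sum>j\<le>n. \<Sum>k\<le>n. c j k * x k * cnj (x j)) \<ge> 0) \<and>
     (\<forall>j k. c j k = (\<Sum>s=- int j..int k.
        structure_coef w j k s * (if s \<ge> 0 then c 0 (nat s) else cnj (c 0 (nat (- s))))))"

definition varying_gaussian_process ::
  "(nat \<Rightarrow> complex \<Rightarrow> complex) \<Rightarrow> 'a measure \<Rightarrow> (nat \<Rightarrow> 'a \<Rightarrow> complex) \<Rightarrow> bool" where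
  "varying_gaussian_process w P X \<longleftrightarrow>
     prob_space P \<and>
     (\<forall>n. X n \<in> borel_measurable P) \<and>
     jointly_normal P X \<and>
     (\<forall>n. integrable P (\<lambda>\<omega>. (cmod (X n \<omega>))\<^sup>2)) \<and>
     (\<forall>n. (LINT \<omega>|P. X n \<omega>) = 0) \<and>
     generalized_toeplitz w (covariance P X)"

definition is_spectral_measure ::
  "(nat \<Rightarrow> complex \<Rightarrow> complex) \<Rightarrow> 'a measure \<Rightarrow> (nat \<Rightarrow> 'a \<Rightarrow> complex) \<Rightarrow> complex measure \<Rightarrow> bool" where
  "is_spectral_measure w P X \<sigma> \<longleftrightarrow>
     \<sigma> \<in> circle_measures \<and>
     (\<forall>j k. covariance P X j k = (LINT z|\<sigma>. cnj (w j z) * w k z))"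


subsection \<open>Prediction\<close>

definition process_shift :: "(nat \<Rightarrow> 'a \<Rightarrow> complex) \<Rightarrow> nat \<Rightarrow> 'a \<Rightarrow> complex" where
  "process_shift X = (\<lambda>k. X (Suc k))"

text \<open>\<open>f(\<Z>) X\<^sub>0\<close> for \<open>f\<close> in the span of the \<open>w k\<close>, where \<open>\<Z>\<^sup>k X\<^sub>0\<close> is \<open>(process_shift ^^ k) X 0\<close>.\<close>

definition eval_at_shift ::
  "(nat \<Rightarrow> complex \<Rightarrow> complex) \<Rightarrow> (complex \<Rightarrow> complex) \<Rightarrow> (nat \<Rightarrow> 'a \<Rightarrow> complex) \<Rightarrow> 'a \<Rightarrow> complex" where
  "eval_at_shift w f X =
     (\<lambda>\<omega>. \<Sum>k | coef w f (int k) \<noteq> 0. coef w f (int k) * (process_shift ^^ k) X 0 \<omega>)"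

definition forward_prediction :: "'a measure \<Rightarrow> (nat \<Rightarrow> 'a \<Rightarrow> complex) \<Rightarrow> nat \<Rightarrow> 'a \<Rightarrow> complex" where
  "forward_prediction P X n = l2_proj P (lin X {..<n}) (X n)"

definition backward_prediction :: "'a measure \<Rightarrow> (nat \<Rightarrow> 'a \<Rightarrow> complex) \<Rightarrow> nat \<Rightarrow> 'a \<Rightarrow> complex" where
  "backward_prediction P X n = l2_proj P (lin X {1..n}) (X 0)"

definition forward_innovation :: "'a measure \<Rightarrow> (nat \<Rightarrow> 'a \<Rightarrow> complex) \<Rightarrow> nat \<Rightarrow> 'a \<Rightarrow> complex" where
  "forward_innovation P X n = (\<lambda>\<omega>. X n \<omega> - forward_prediction P X n \<omega>)"

definition backward_innovation :: "'a measure \<Rightarrow> (nat \<Rightarrow> 'a \<Rightarrow> complex) \<Rightarrow> nat \<Rightarrow> 'a \<Rightarrow> complex" where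
  "backward_innovation P X n = (\<lambda>\<omega>. X 0 \<omega> - backward_prediction P X n \<omega>)"

end

theory Submission
  imports Defs
begin

text \<open>Since \<open>w\<close> in \<open>L\<^sup>2(\<sigma>)\<close> and \<open>X\<close> in \<open>L\<^sup>2(P)\<close> have the same Gram matrix, the linear map
  \<open>w\<^sub>k \<mapsto> X\<^sub>k\<close>, which is \<open>f \<mapsto> f(\<Z>)X\<^sub>0\<close>, is isometric. It carries the Gram--Schmidt residual of
  \<open>w\<^sub>m\<close> to the innovation of \<open>X\<^sub>m\<close>, and the monic polynomial is that residual. If the residual
  vanishes in \<open>L\<^sup>2(\<sigma>)\<close>, the normalization gives the zero function, and the innovation is zero
  almost surely, so the formulas persist for measures carried by finitely many points.\<close>

section \<open>Square integrable functions and the form \<open>l2_inner\<close>\<close>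

definition sq_integrable :: "'a measure \<Rightarrow> ('a \<Rightarrow> complex) set" where
  "sq_integrable M = {f \<in> borel_measurable M. integrable M (\<lambda>x. (cmod (f x))\<^sup>2)}"

text \<open>Domination by |f|^2 + |g|^2. The additivity rules for \<open>l2_inner\<close> below rest
  on it, since the Bochner integral is additive only on integrable functions.\<close>

lemma sq_integrable_prod:
  assumes "f \<in> sq_integrable M" "g \<in> sq_integrable M"
  shows "integrable M (\<lambda>x. f x * cnj (g x))"
proof (rule Bochner_Integration.integrable_bound)
  show "integrable M (\<lambda>x. (cmod (f x))\<^sup>2 + (cmod (g x))\<^sup>2)"
    using assms by (auto simp: sq_integrable_def)
  have [measurable]: "f \<in> borel_measurable M" "g \<in> borel_measurable M"
    using assms by (auto simp: sq_integrable_def)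
  have [measurable]: "(\<lambda>x. cnj (g x)) \<in> borel_measurable M"
    by (rule borel_measurable_continuous_on[OF _ \<open>g \<in> borel_measurable M\<close>])
       (intro continuous_intros)
  show "(\<lambda>x. f x * cnj (g x)) \<in> borel_measurable M"
    by measurable
  have "a * b \<le> a\<^sup>2 + b\<^sup>2" for a b :: real
    using zero_le_power2[of "a - b"] zero_le_power2[of a] zero_le_power2[of b]
    unfolding power2_diff by linarith
  then show "AE x in M. norm (f x * cnj (g x)) \<le> norm ((cmod (f x))\<^sup>2 + (cmod (g x))\<^sup>2)"
    by (simp add: norm_mult)
qed

lemma sq_integrable_zero: "(\<lambda>x. 0) \<in> sq_integrable M"
  by (simp add: sq_integrable_def)

lemma sq_integrable_mult:
  assumes "f \<in> sq_integrable M"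
  shows "(\<lambda>x. c * f x) \<in> sq_integrable M"
  using assms by (auto simp: sq_integrable_def norm_mult power_mult_distrib)

lemma sq_integrable_add:
  assumes "f \<in> sq_integrable M" "g \<in> sq_integrable M"
  shows "(\<lambda>x. f x + g x) \<in> sq_integrable M"
proof -
  have [measurable]: "f \<in> borel_measurable M" "g \<in> borel_measurable M"
    using assms by (auto simp: sq_integrable_def)
  have "integrable M (\<lambda>x. (cmod (f x + g x))\<^sup>2)"
  proof (rule Bochner_Integration.integrable_bound)
    show "integrable M (\<lambda>x. 2 * (cmod (f x))\<^sup>2 + 2 * (cmod (g x))\<^sup>2)"
      using assms by (auto simp: sq_integrable_def)
    have "(cmod (a + b))\<^sup>2 \<le> 2 * (cmod a)\<^sup>2 + 2 * (cmod b)\<^sup>2" for a b :: complex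
    proof -
      have "(cmod (a + b))\<^sup>2 \<le> (cmod a + cmod b)\<^sup>2"
        by (intro power_mono norm_triangle_ineq norm_ge_zero)
      also have "\<dots> \<le> 2 * (cmod a)\<^sup>2 + 2 * (cmod b)\<^sup>2"
        using zero_le_power2[of "cmod a - cmod b"] unfolding power2_diff power2_sum by linarith
      finally show ?thesis .
    qed
    then show "AE x in M. norm ((cmod (f x + g x))\<^sup>2)
        \<le> norm (2 * (cmod (f x))\<^sup>2 + 2 * (cmod (g x))\<^sup>2)"
      by simp
  qed measurable
  then show ?thesis
    by (simp add: sq_integrable_def)
qed

lemma sq_integrable_diff:
  assumes "f \<in> sq_integrable M" "g \<in> sq_integrable M"
  shows "(\<lambda>x. f x - g x) \<in> sq_integrable M"
  using sq_integrable_add[OF assms(1) sq_integrable_mult[OF assms(2), of "-1"]] by simp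

lemma sq_integrable_sum:
  assumes "\<And>j. j \<in> J \<Longrightarrow> v j \<in> sq_integrable M"
  shows "(\<lambda>x. \<Sum>j\<in>J. a j * v j x) \<in> sq_integrable M"
  using assms
  by (induction J rule: infinite_finite_induct)
     (auto simp: sq_integrable_zero intro!: sq_integrable_add sq_integrable_mult)

lemma l2_inner_diff_left:
  assumes "f \<in> sq_integrable M" "g \<in> sq_integrable M" "h \<in> sq_integrable M"
  shows "l2_inner M (\<lambda>x. f x - g x) h = l2_inner M f h - l2_inner M g h"
  unfolding l2_inner_def left_diff_distrib
  by (intro Bochner_Integration.integral_diff sq_integrable_prod assms)

lemma l2_inner_mult_left: "l2_inner M (\<lambda>x. c * f x) h = c * l2_inner M f h"
  by (simp add: l2_inner_def mult.assoc)

lemma l2_inner_commute: "l2_inner M f g = cnj (l2_inner M g f)"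
proof -
  have "cnj (l2_inner M g f) = (LINT x|M. cnj (g x * cnj (f x)))"
    unfolding l2_inner_def by (rule Bochner_Integration.integral_cnj[symmetric])
  then show ?thesis
    by (simp add: l2_inner_def mult.commute)
qed

lemma l2_inner_sum_left:
  assumes "\<And>j. j \<in> J \<Longrightarrow> v j \<in> sq_integrable M" "h \<in> sq_integrable M"
  shows "l2_inner M (\<lambda>x. \<Sum>j\<in>J. a j * v j x) h = (\<Sum>j\<in>J. a j * l2_inner M (v j) h)"
proof -
  have "l2_inner M (\<lambda>x. \<Sum>j\<in>J. a j * v j x) h = (LINT x|M. (\<Sum>j\<in>J. a j * (v j x * cnj (h x))))"
    by (simp add: l2_inner_def sum_distrib_right mult.assoc)
  also have "\<dots> = (\<Sum>j\<in>J. (LINT x|M. a j * (v j x * cnj (h x))))"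
    by (intro Bochner_Integration.integral_sum integrable_mult_right sq_integrable_prod assms)
  finally show ?thesis
    by (simp add: l2_inner_def)
qed

lemma l2_inner_sum_right:
  assumes "\<And>j. j \<in> J \<Longrightarrow> v j \<in> sq_integrable M" "h \<in> sq_integrable M"
  shows "l2_inner M h (\<lambda>x. \<Sum>j\<in>J. a j * v j x) = (\<Sum>j\<in>J. cnj (a j) * l2_inner M h (v j))"
  using assms by (subst l2_inner_commute) (simp add: l2_inner_sum_left l2_inner_commute[of M h])

lemma l2_inner_self: "l2_inner M f f = of_real ((l2_norm M f)\<^sup>2)"
  unfolding l2_inner_def l2_norm_def complex_norm_square[symmetric] integral_complex_of_real
  by simp

lemma l2_norm_eq_0_iff_AE:
  assumes "f \<in> sq_integrable M"
  shows "l2_norm M f = 0 \<longleftrightarrow> (AE x in M. f x = 0)"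
  using assms by (simp add: l2_norm_def sq_integrable_def integral_nonneg_eq_0_iff_AE)

lemma l2_inner_null_right:
  assumes "AE x in M. g x = 0"
  shows "l2_inner M f g = 0"
  unfolding l2_inner_def using assms by (intro integral_eq_zero_AE) auto

section \<open>Gram-Schmidt residuals without linear independence\<close>

text \<open>The function that \<open>gram_schmidt\<close> divides by its norm. It expands with
  coefficient 1 at \<open>v k\<close> even when its norm is zero, whereas the normalized function is
  then identically 0 and retains nothing of \<open>v k\<close>.\<close>

definition gs_residual :: "'a measure \<Rightarrow> (nat \<Rightarrow> 'a \<Rightarrow> complex) \<Rightarrow> nat \<Rightarrow> 'a \<Rightarrow> complex" where
  "gs_residual M v k = (\<lambda>x. v k x
     - (\<Sum>j<k. l2_inner M (v k) (gram_schmidt M v j) * gram_schmidt M v j x))"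

lemma gram_schmidt_eq:
  "gram_schmidt M v k = (\<lambda>x. inverse (of_real (l2_norm M (gs_residual M v k))) * gs_residual M v k x)"
  by (subst gram_schmidt.simps) (simp add: Let_def gs_residual_def field_simps)

text \<open>Interchanges the triangular double sum over i \<le> j < k, so that the coefficient of
  each \<open>v i\<close> is collected.\<close>

lemma gs_sum_reorder:
  fixes a :: "nat \<Rightarrow> complex"
  assumes "\<And>j x. j < k \<Longrightarrow> g j x = (\<Sum>i\<le>j. c j i * v i x)"
  shows "(\<Sum>j<k. a j * g j x) = (\<Sum>i<k. (\<Sum>j\<in>{i..<k}. a j * c j i) * v i x)"
proof -
  have "(\<Sum>j<k. a j * g j x) = (\<Sum>j<k. \<Sum>i\<in>{i. i < k \<and> i \<le> j}. a j * c j i * v i x)"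
    by (intro sum.cong refl) (auto simp: assms sum_distrib_left mult.assoc intro!: sum.cong)
  also have "\<dots> = (\<Sum>j\<in>{..<k}. \<Sum>i\<in>{i. i \<in> {..<k} \<and> i \<le> j}. a j * c j i * v i x)"
    by simp
  also have "\<dots> = (\<Sum>i\<in>{..<k}. \<Sum>j\<in>{j. j \<in> {..<k} \<and> i \<le> j}. a j * c j i * v i x)"
    by (rule sum.swap_restrict) auto
  also have "\<dots> = (\<Sum>i<k. (\<Sum>j\<in>{i..<k}. a j * c j i) * v i x)"
    by (intro sum.cong refl) (auto simp: sum_distrib_right intro!: sum.cong)
  finally show ?thesis .
qed

text \<open>By strong induction each earlier \<open>gram_schmidt M v j\<close>, a multiple of its
  residual, is a combination of \<open>v 0\<close> to \<open>v j\<close>; subtracting such functions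
  leaves the coefficient of \<open>v k\<close> untouched.\<close>

lemma gs_residual_expansion: "\<exists>b. \<forall>x. gs_residual M v k x = v k x - (\<Sum>j<k. b j * v j x)"
proof (induction k rule: less_induct)
  case (less k)
  have "\<exists>c. \<forall>x. gram_schmidt M v j x = (\<Sum>i\<le>j. c i * v i x)" if jk: "j < k" for j
  proof -
    obtain b where b: "\<And>x. gs_residual M v j x = v j x - (\<Sum>i<j. b i * v i x)"
      using less.IH[OF jk] by blast
    define t where "t = inverse (complex_of_real (l2_norm M (gs_residual M v j)))"
    have "gram_schmidt M v j x = (\<Sum>i\<le>j. (if i = j then t else - t * b i) * v i x)" for x
    proof -
      have "(\<Sum>i<j. (if i = j then t else - t * b i) * v i x) = - t * (\<Sum>i<j. b i * v i x)"
        unfolding sum_distrib_left by (intro sum.cong) auto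
      then show ?thesis
        by (simp add: gram_schmidt_eq b t_def[symmetric] lessThan_Suc_atMost[symmetric]
            right_diff_distrib)
    qed
    then show ?thesis by (intro exI allI)
  qed
  then obtain c where c: "\<And>j x. j < k \<Longrightarrow> gram_schmidt M v j x = (\<Sum>i\<le>j. c j i * v i x)"
    by metis
  show ?case
  proof (intro exI allI)
    fix x
    show "gs_residual M v k x = v k x
        - (\<Sum>i<k. (\<Sum>j\<in>{i..<k}. l2_inner M (v k) (gram_schmidt M v j) * c j i) * v i x)"
      unfolding gs_residual_def by (subst gs_sum_reorder) (use c in auto)
  qed
qed

lemma gs_residual_sq_integrable:
  assumes "\<And>j. v j \<in> sq_integrable M"
  shows "gs_residual M v k \<in> sq_integrable M"
proof -
  obtain b where "gs_residual M v k = (\<lambda>x. v k x - (\<Sum>j<k. b j * v j x))"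
    using gs_residual_expansion[of M v k] by blast
  then show ?thesis
    using assms by (simp add: sq_integrable_diff sq_integrable_sum)
qed

lemma gram_schmidt_sq_integrable:
  assumes "\<And>j. v j \<in> sq_integrable M"
  shows "gram_schmidt M v k \<in> sq_integrable M"
  unfolding gram_schmidt_eq by (intro sq_integrable_mult gs_residual_sq_integrable assms)

text \<open>The induction hypothesis makes the earlier normalized functions pairwise orthogonal.
  Each of them has norm 1 or is the zero function, and in both cases the subtracted term with index
  j removes exactly the inner product with \<open>gram_schmidt M v j\<close>.\<close>

lemma gs_residual_orthogonal_gram_schmidt:
  assumes v: "\<And>j. v j \<in> sq_integrable M"
  shows "j < k \<Longrightarrow> l2_inner M (gs_residual M v k) (gram_schmidt M v j) = 0"
proof (induction k arbitrary: j rule: less_induct)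
  case (less k)
  let ?g = "gram_schmidt M v" and ?r = "gs_residual M v"
  have g: "?g i \<in> sq_integrable M" for i
    by (intro gram_schmidt_sq_integrable v)
  have orth: "l2_inner M (?g i) (?g j) = 0" if "i < k" "i \<noteq> j" for i
  proof (cases "j < i")
    case True
    then show ?thesis
      using less.IH[OF \<open>i < k\<close>] by (subst gram_schmidt_eq) (simp add: l2_inner_mult_left)
  next
    case False
    then have "i < j" using that by simp
    then have "l2_inner M (?g j) (?g i) = 0"
      using less.IH[OF \<open>j < k\<close>] by (subst gram_schmidt_eq) (simp add: l2_inner_mult_left)
    then show ?thesis
      by (subst l2_inner_commute) simp
  qed
  \<comment> \<open>If the residual has norm zero, division by zero makes \<open>?g j\<close> the
    zero function and both sides vanish; otherwise \<open>?g j\<close> has norm 1.\<close>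
  have self: "l2_inner M (v k) (?g j) * l2_inner M (?g j) (?g j) = l2_inner M (v k) (?g j)"
  proof (cases "l2_norm M (?r j) = 0")
    case True
    then have "?g j = (\<lambda>x. 0)"
      by (subst gram_schmidt_eq) simp
    then show ?thesis by (simp add: l2_inner_def)
  next
    case False
    let ?t = "inverse (complex_of_real (l2_norm M (?r j)))"
    have "l2_inner M (?g j) (?g j) = ?t * cnj (l2_inner M (?g j) (?r j))"
      by (subst gram_schmidt_eq) (simp add: l2_inner_mult_left l2_inner_commute[of _ "?r j"])
    also have "l2_inner M (?g j) (?r j) = ?t * l2_inner M (?r j) (?r j)"
      by (subst gram_schmidt_eq) (simp add: l2_inner_mult_left)
    also have "?t * cnj (?t * l2_inner M (?r j) (?r j)) = 1"
      using False by (simp add: l2_inner_self power2_eq_square field_simps)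
    finally have "l2_inner M (?g j) (?g j) = 1" .
    then show ?thesis by simp
  qed
  have "l2_inner M (?r k) (?g j) = l2_inner M (v k) (?g j)
      - (\<Sum>i<k. l2_inner M (v k) (?g i) * l2_inner M (?g i) (?g j))"
    unfolding gs_residual_def
    by (simp add: l2_inner_diff_left l2_inner_sum_left sq_integrable_sum v g)
  also have "(\<Sum>i<k. l2_inner M (v k) (?g i) * l2_inner M (?g i) (?g j))
      = (\<Sum>i<k. if i = j then l2_inner M (v k) (?g j) else 0)"
    by (intro sum.cong refl) (auto simp: orth self)
  also have "\<dots> = l2_inner M (v k) (?g j)"
    using less.prems by simp
  finally show ?case by simp
qed

text \<open>Orthogonality to \<open>gram_schmidt M v j\<close> says nothing about \<open>v j\<close>
  when that function is 0, so the proof passes through the residual of \<open>v j\<close>. This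
  residual is null or a multiple of the normalized function, and it differs from \<open>v j\<close>
  only by normalized functions of index below j.\<close>

lemma gs_residual_orthogonal:
  assumes v: "\<And>j. v j \<in> sq_integrable M" and "j < k"
  shows "l2_inner M (gs_residual M v k) (v j) = 0"
proof -
  let ?g = "gram_schmidt M v" and ?r = "gs_residual M v"
  note rk = gs_residual_sq_integrable[OF v, where k = k]
    and rj = gs_residual_sq_integrable[OF v, where k = j]
  have "l2_inner M (?r k) (?r j) = 0"
  proof (cases "l2_norm M (?r j) = 0")
    case True
    then show ?thesis
      using l2_norm_eq_0_iff_AE[OF rj] by (intro l2_inner_null_right) simp
  next
    case False
    then have "?r j = (\<lambda>x. of_real (l2_norm M (?r j)) * ?g j x)"
      by (simp add: gram_schmidt_eq[of M v j] fun_eq_iff)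
    then have "l2_inner M (?r j) (?r k) = of_real (l2_norm M (?r j)) * l2_inner M (?g j) (?r k)"
      by (metis l2_inner_mult_left)
    moreover have "l2_inner M (?g j) (?r k) = 0"
      using gs_residual_orthogonal_gram_schmidt[OF v \<open>j < k\<close>] by (subst l2_inner_commute) simp
    ultimately show ?thesis
      by (subst l2_inner_commute) simp
  qed
  moreover have "l2_inner M (?r k) (?r j) = l2_inner M (?r k) (v j)"
  proof -
    have "l2_inner M (?r j) (?r k) = l2_inner M (v j) (?r k)
        - (\<Sum>i<j. l2_inner M (v j) (?g i) * l2_inner M (?g i) (?r k))"
      unfolding gs_residual_def[of M v j]
      by (simp add: l2_inner_diff_left l2_inner_sum_left sq_integrable_sum v rk
          gram_schmidt_sq_integrable)
    moreover have "l2_inner M (?g i) (?r k) = 0" if "i < j" for i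
      using gs_residual_orthogonal_gram_schmidt[OF v, of i k] that \<open>j < k\<close>
      by (subst l2_inner_commute) simp
    ultimately have "l2_inner M (?r j) (?r k) = l2_inner M (v j) (?r k)"
      by simp
    then show ?thesis
      by (metis l2_inner_commute)
  qed
  ultimately show ?thesis by simp
qed

section \<open>Orthogonal projection onto a finite span\<close>

text \<open>The function \<open>g\<close> is a witness for the choice in \<open>l2_proj\<close>, so
  the chosen \<open>p\<close> satisfies the defining property as well. The difference of
  \<open>p\<close> and \<open>g\<close> lies in the span and is orthogonal to the span, hence to
  itself, and so vanishes almost everywhere.\<close>

lemma l2_proj_AE_eq:
  assumes Y: "\<And>j. j \<in> J \<Longrightarrow> Y j \<in> sq_integrable M" and f: "f \<in> sq_integrable M"
    and g: "g \<in> lin Y J" and orth: "\<And>j. j \<in> J \<Longrightarrow> l2_inner M (\<lambda>x. f x - g x) (Y j) = 0"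
  shows "AE x in M. l2_proj M (lin Y J) f x = g x"
proof -
  let ?orth = "\<lambda>g. g \<in> lin Y J \<and> (\<forall>h\<in>lin Y J. l2_inner M (\<lambda>x. f x - g x) h = 0)"
  define p where "p = l2_proj M (lin Y J) f"
  have lin_sq: "h \<in> sq_integrable M" if "h \<in> lin Y J" for h
    using that Y by (auto simp: lin_def intro!: sq_integrable_sum)
  have "?orth g"
  proof (intro conjI ballI g)
    fix h assume "h \<in> lin Y J"
    then obtain a where h: "h = (\<lambda>x. \<Sum>j\<in>J. a j * Y j x)"
      by (auto simp: lin_def)
    show "l2_inner M (\<lambda>x. f x - g x) h = 0"
      unfolding h by (subst l2_inner_sum_right) (auto simp: Y orth f lin_sq[OF g] sq_integrable_diff)
  qed
  then have "?orth p"
    unfolding p_def l2_proj_def by (rule someI[where P = ?orth])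
  have p: "p \<in> lin Y J" using \<open>?orth p\<close> by blast
  define d where "d = (\<lambda>x. p x - g x)"
  have "d \<in> lin Y J"
  proof -
    obtain a b where "p = (\<lambda>x. \<Sum>j\<in>J. a j * Y j x)" "g = (\<lambda>x. \<Sum>j\<in>J. b j * Y j x)"
      using p g by (auto simp: lin_def)
    then have "d = (\<lambda>x. \<Sum>j\<in>J. (a j - b j) * Y j x)"
      by (simp add: d_def sum_subtractf left_diff_distrib)
    then show ?thesis by (auto simp: lin_def)
  qed
  have "l2_inner M (\<lambda>x. (f x - g x) - (f x - p x)) d
      = l2_inner M (\<lambda>x. f x - g x) d - l2_inner M (\<lambda>x. f x - p x) d"
    by (intro l2_inner_diff_left sq_integrable_diff f lin_sq p g \<open>d \<in> lin Y J\<close>)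
  then have "l2_inner M d d = 0"
    using \<open>?orth g\<close> \<open>?orth p\<close> \<open>d \<in> lin Y J\<close> by (simp add: d_def)
  then have "AE x in M. d x = 0"
    using l2_norm_eq_0_iff_AE[OF lin_sq[OF \<open>d \<in> lin Y J\<close>]] by (simp add: l2_inner_self)
  then show ?thesis
    by (simp add: d_def p_def)
qed

section \<open>Coefficients and evaluation at the shift\<close>

text \<open>Extending \<open>a\<close> by zero to all integers gives a coefficient family; linear
  independence of the two-sided system on the circle makes it the only one, so the definite
  description in \<open>coef\<close> denotes it.\<close>

lemma coef_span:
  assumes adm: "admissible_system w"
    and f: "\<And>z. z \<in> circle \<Longrightarrow> f z = (\<Sum>k\<le>n. a k * w k z)"
  shows "coef w f (int k) = (if k \<le> n then a k else 0)"
proof -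
  have indep: "(\<forall>z\<in>circle. (\<Sum>s\<in>S. a s * two_sided w s z) = 0) \<Longrightarrow> \<forall>s\<in>S. a s = 0"
    if "finite S" for S a
    using adm that unfolding admissible_system_def by simp
  define A :: "int \<Rightarrow> complex" where "A s = (if 0 \<le> s \<and> s \<le> int n then a (nat s) else 0)" for s
  let ?Q = "\<lambda>a. finite {s. a s \<noteq> 0} \<and>
     (\<forall>z\<in>circle. f z = (\<Sum>s | a s \<noteq> 0. a s * two_sided w s z))"
  have supp: "{s. A s \<noteq> 0} \<subseteq> int ` {..n}"
    by (auto simp: A_def image_iff split: if_splits intro!: bexI[of _ "nat _"])
  have "f z = (\<Sum>s | A s \<noteq> 0. A s * two_sided w s z)" if "z \<in> circle" for z
  proof -
    have "(\<Sum>s | A s \<noteq> 0. A s * two_sided w s z) = (\<Sum>s\<in>int ` {..n}. A s * two_sided w s z)"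
      by (rule sum.mono_neutral_left) (use supp in auto)
    also have "\<dots> = (\<Sum>k\<le>n. a k * w k z)"
      by (subst sum.reindex) (auto simp: A_def two_sided_def inj_on_def)
    finally show ?thesis using f[OF that] by simp
  qed
  then have QA: "?Q A"
    using finite_subset[OF supp] by auto
  have "B = A" if QB: "?Q B" for B
  proof
    fix s
    \<comment> \<open>Adjoining s lets independence be applied at s itself, even if both families
      vanish there.\<close>
    define S where "S = {s. A s \<noteq> 0} \<union> {s. B s \<noteq> 0} \<union> {s}"
    have S: "finite S" using QA QB by (auto simp: S_def)
    have "(\<Sum>s\<in>S. (B s - A s) * two_sided w s z) = 0" if "z \<in> circle" for z
    proof -
      have "(\<Sum>s\<in>S. C s * two_sided w s z) = f z" if "?Q C" "{s. C s \<noteq> 0} \<subseteq> S" for C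
      proof -
        have "(\<Sum>s\<in>S. C s * two_sided w s z) = (\<Sum>s | C s \<noteq> 0. C s * two_sided w s z)"
          using S that(2) by (intro sum.mono_neutral_right) auto
        then show ?thesis using that(1) \<open>z \<in> circle\<close> by simp
      qed
      from this[OF QA] this[OF QB]
      have "(\<Sum>s\<in>S. A s * two_sided w s z) = f z" "(\<Sum>s\<in>S. B s * two_sided w s z) = f z"
        by (auto simp: S_def)
      then show ?thesis by (simp add: left_diff_distrib sum_subtractf)
    qed
    then have "\<forall>s\<in>S. B s - A s = 0"
      using indep[OF S, of "\<lambda>s. B s - A s"] by blast
    then show "B s = A s" by (simp add: S_def)
  qed
  then have "coef w f = A"
    unfolding coef_def using QA by (intro the_equality)
  then show ?thesis by (simp add: A_def)
qed

text \<open>The start index \<open>i\<close> is kept general because each shift raises it in the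
  induction.\<close>

lemma process_shift_pow: "(process_shift ^^ k) X i = X (i + k)"
  by (induction k arbitrary: i) (auto simp: process_shift_def)

lemma eval_at_shift_span:
  assumes "admissible_system w" "\<And>z. z \<in> circle \<Longrightarrow> f z = (\<Sum>k\<le>n. a k * w k z)"
  shows "eval_at_shift w f X = (\<lambda>\<omega>. \<Sum>k\<le>n. a k * X k \<omega>)"
proof
  have coef: "coef w f (int k) = (if k \<le> n then a k else 0)" for k
    using assms by (rule coef_span)
  fix \<omega>
  show "eval_at_shift w f X \<omega> = (\<Sum>k\<le>n. a k * X k \<omega>)"
    unfolding eval_at_shift_def coef process_shift_pow
    by (rule sum.mono_neutral_cong_left) auto
qed

section \<open>Prediction for an arbitrary order of the system\<close>

text \<open>A continuous function is bounded on the compact circle, which is the whole space of the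
  finite measure.\<close>

lemma continuous_sq_integrable:
  assumes "\<mu> \<in> circle_measures" "continuous_on circle f"
  shows "f \<in> sq_integrable \<mu>"
proof -
  interpret finite_measure \<mu> using assms by (simp add: circle_measures_def)
  have sets: "sets \<mu> = sets (restrict_space borel circle)"
    using assms by (simp add: circle_measures_def)
  have meas: "f \<in> borel_measurable \<mu>"
    using borel_measurable_continuous_on_restrict[OF assms(2)] sets
    by (simp cong: measurable_cong_sets)
  have "space \<mu> = circle"
    using sets_eq_imp_space_eq[OF sets] by (simp add: space_restrict_space)
  moreover have "bounded (f ` circle)"
    by (intro compact_imp_bounded compact_continuous_image assms(2) compact_sphere)
  ultimately obtain B where "\<And>z. z \<in> space \<mu> \<Longrightarrow> cmod (f z) \<le> B"
    unfolding bounded_iff by blast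
  then have "AE z in \<mu>. norm ((cmod (f z))\<^sup>2) \<le> B\<^sup>2"
    by (auto intro!: AE_I2 power_mono)
  then have "integrable \<mu> (\<lambda>z. (cmod (f z))\<^sup>2)"
    using meas by (intro integrable_const_bound) auto
  then show ?thesis using meas by (simp add: sq_integrable_def)
qed

text \<open>The index permutation \<open>\<pi>\<close> gives the order in which \<open>w\<^sub>0, \<dots>, w\<^sub>n\<close> are orthonormalized: the
  identity for forward prediction, and \<open>j \<mapsto> n - j\<close> for backward prediction.\<close>

lemma prediction_gram_schmidt:
  fixes \<pi> :: "nat \<Rightarrow> nat"
  assumes adm: "admissible_system w" and proc: "varying_gaussian_process w P X"
    and spec: "is_spectral_measure w P X \<sigma>" and bij: "bij_betw \<pi> {..n} {..n}"
  defines "f \<equiv> gram_schmidt \<sigma> (\<lambda>j. w (\<pi> j)) n"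
  shows "AE \<omega> in P. l2_proj P (lin X ({..n} - {\<pi> n})) (X (\<pi> n)) \<omega>
      = X (\<pi> n) \<omega> - eval_at_shift w (\<lambda>z. f z / coef w f (int (\<pi> n))) X \<omega>"
proof -
  let ?J = "{..n} - {\<pi> n}"
  have w: "w k \<in> sq_integrable \<sigma>" for k
    using adm spec
    by (auto simp: admissible_system_def is_spectral_measure_def intro!: continuous_sq_integrable)
  have X: "X k \<in> sq_integrable P" for k
    using proc by (auto simp: varying_gaussian_process_def sq_integrable_def)
  have gram: "l2_inner P (X k) (X j) = l2_inner \<sigma> (w k) (w j)" for j k
    using spec unfolding is_spectral_measure_def covariance_def
    by (simp add: l2_inner_def mult.commute)
  have isometry: "l2_inner P (\<lambda>\<omega>. \<Sum>k\<le>n. a k * X k \<omega>) (\<lambda>\<omega>. \<Sum>k\<le>n. b k * X k \<omega>)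
      = l2_inner \<sigma> (\<lambda>z. \<Sum>k\<le>n. a k * w k z) (\<lambda>z. \<Sum>k\<le>n. b k * w k z)" for a b
    by (simp add: l2_inner_sum_left l2_inner_sum_right sq_integrable_sum w X gram)
  have m: "\<pi> n \<le> n" using bij_betwE[OF bij] by simp
  have bij': "bij_betw \<pi> {..<n} ?J"
  proof -
    have "{..n} - {n} = {..<n}" by auto
    moreover have "\<pi> ` ({..n} - {n}) = \<pi> ` {..n} - \<pi> ` {n}"
      using bij by (intro inj_on_image_set_diff[of _ "{..n}"]) (auto simp: bij_betw_def)
    ultimately show ?thesis
      using bij by (auto simp: bij_betw_def intro: inj_on_subset)
  qed
  define r where "r = gs_residual \<sigma> (\<lambda>j. w (\<pi> j)) n"
  obtain b where b: "\<And>z. r z = w (\<pi> n) z - (\<Sum>j<n. b j * w (\<pi> j) z)"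
    unfolding r_def using gs_residual_expansion by blast
  \<comment> \<open>The coefficients \<open>b\<close> are numbered by position in the order \<pi>;
    \<open>c\<close> renumbers them by the index of the function. On \<open>?J\<close> the inverse
    is well defined by \<open>bij'\<close>.\<close>
  define c where "c i = b (inv_into {..<n} \<pi> i)" for i
  \<comment> \<open>The entry 1 at \<open>\<pi> n\<close> is what makes the residual monic.\<close>
  define a where "a i = (if i = \<pi> n then 1 else - c i)" for i
  \<comment> \<open>Stated for arbitrary \<open>u\<close> because it serves both for the values of
    the \<open>w k\<close> and for those of the \<open>X k\<close>.\<close>
  have split: "(\<Sum>k\<le>n. a k * u k) = u (\<pi> n) - (\<Sum>k\<in>?J. c k * u k)" for u
  proof -
    have "(\<Sum>k\<le>n. a k * u k) = u (\<pi> n) + (\<Sum>k\<in>?J. a k * u k)"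
      using m by (subst sum.remove[of _ "\<pi> n"]) (auto simp: a_def)
    also have "(\<Sum>k\<in>?J. a k * u k) = (\<Sum>k\<in>?J. - (c k * u k))"
      by (intro sum.cong) (auto simp: a_def)
    finally show ?thesis by (simp add: sum_negf)
  qed
  have r: "r = (\<lambda>z. \<Sum>k\<le>n. a k * w k z)"
  proof
    fix z
    have "(\<Sum>k\<in>?J. c k * w k z) = (\<Sum>j<n. c (\<pi> j) * w (\<pi> j) z)"
      using bij' by (rule sum.reindex_bij_betw[symmetric])
    also have "\<dots> = (\<Sum>j<n. b j * w (\<pi> j) z)"
      using bij' by (intro sum.cong) (auto simp: c_def bij_betw_def)
    finally show "r z = (\<Sum>k\<le>n. a k * w k z)"
      by (simp add: b split)
  qed
  define R where "R = (\<lambda>\<omega>. \<Sum>k\<le>n. a k * X k \<omega>)"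
  \<comment> \<open>Unit coefficient vectors, so that \<open>isometry\<close> applies to a single
    \<open>w i\<close> and \<open>X i\<close>.\<close>
  have unit: "(\<Sum>k\<le>n. (if k = i then 1 else 0) * u k) = u i" if "i \<le> n" for i and u :: "nat \<Rightarrow> complex"
    using that by (simp add: if_distrib[of "\<lambda>t. t * _"] cong: if_cong)
  have orth: "l2_inner P R (X i) = 0" if "i \<in> ?J" for i
  proof -
    have "i \<in> \<pi> ` {..<n}"
      using that bij' by (simp add: bij_betw_def)
    then obtain j where "j < n" "i = \<pi> j"
      by blast
    then have "l2_inner \<sigma> r (w i) = 0"
      unfolding r_def using gs_residual_orthogonal[of "\<lambda>j. w (\<pi> j)" \<sigma> j n] w by simp
    then show ?thesis
      using isometry[of a "\<lambda>k. if k = i then 1 else 0"] unit[of i] that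
      by (simp add: r R_def)
  qed
  \<comment> \<open>By \<open>split\<close>, subtracting this candidate from
    \<open>X (\<pi> n)\<close> leaves \<open>R\<close>, which is orthogonal to every
    \<open>X i\<close> with i in \<open>?J\<close>.\<close>
  have "AE \<omega> in P. l2_proj P (lin X ?J) (X (\<pi> n)) \<omega> = (\<Sum>k\<in>?J. c k * X k \<omega>)"
    using orth split by (intro l2_proj_AE_eq X) (auto simp: lin_def R_def)
  then have proj: "AE \<omega> in P. l2_proj P (lin X ?J) (X (\<pi> n)) \<omega> = X (\<pi> n) \<omega> - R \<omega>"
    by (simp add: R_def split)
  let ?t = "inverse (complex_of_real (l2_norm \<sigma> r))"
  have f: "f z = (\<Sum>k\<le>n. (?t * a k) * w k z)" for z
    unfolding f_def gram_schmidt_eq r_def[symmetric]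
    by (simp add: r sum_distrib_left mult.assoc)
  \<comment> \<open>Since the residual is monic, the leading coefficient of \<open>f\<close> is the
    normalizing factor itself; it equals 0 if the residual has norm zero.\<close>
  have cf: "coef w f (int (\<pi> n)) = ?t"
    using coef_span[OF adm f] m by (simp add: a_def)
  \<comment> \<open>The quotient by \<open>?t\<close> is left uncancelled because \<open>?t\<close>
    may be 0.\<close>
  have eval: "eval_at_shift w (\<lambda>z. f z / coef w f (int (\<pi> n))) X
      = (\<lambda>\<omega>. \<Sum>k\<le>n. (?t * a k / ?t) * X k \<omega>)"
    by (rule eval_at_shift_span[OF adm]) (simp only: cf f sum_divide_distrib times_divide_eq_left)
  have "AE \<omega> in P. eval_at_shift w (\<lambda>z. f z / coef w f (int (\<pi> n))) X \<omega> = R \<omega>"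
  proof (cases "l2_norm \<sigma> r = 0")
    \<comment> \<open>Here \<open>?t\<close> is 0 and all coefficients in \<open>eval\<close> are 0,
      while the isometry turns the null residual into an innovation \<open>R\<close> that is null in
      \<open>P\<close>.\<close>
    case True
    then have "l2_inner P R R = 0"
      using isometry[of a a] by (simp add: R_def r[symmetric] l2_inner_self)
    then have "AE \<omega> in P. R \<omega> = 0"
      using l2_norm_eq_0_iff_AE[of R P] by (simp add: R_def sq_integrable_sum X l2_inner_self)
    then show ?thesis
      unfolding eval by (simp add: True)
  next
    case False
    then show ?thesis unfolding eval R_def by simp
  qed
  with proj show ?thesis by eventually_elim simp
qed

text \<open>Two instances of \<open>prediction_gram_schmidt\<close>: the identity order singles out
  \<open>X n\<close> and leaves the indices below n, the reversed order ends with \<open>X 0\<close>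
  and leaves 1 to n. The innovations follow by subtraction.\<close>

theorem mainTheorem3:
  fixes w :: "nat \<Rightarrow> complex \<Rightarrow> complex"
    and P :: "'a measure" and X :: "nat \<Rightarrow> 'a \<Rightarrow> complex"
    and \<sigma> :: "complex measure" and n :: nat
  assumes "admissible_system w"
    and "varying_gaussian_process w P X"
    and "is_spectral_measure w P X \<sigma>"
  shows "(AE \<omega> in P. forward_prediction P X n \<omega> =
            (process_shift ^^ n) X 0 \<omega> - eval_at_shift w (monic_gop w \<sigma> n) X \<omega>) \<and>
         (AE \<omega> in P. forward_innovation P X n \<omega> = eval_at_shift w (monic_gop w \<sigma> n) X \<omega>) \<and>
         (AE \<omega> in P. backward_prediction P X n \<omega> =
            X 0 \<omega> - eval_at_shift w (monic_reversed_gop w \<sigma> n) X \<omega>) \<and>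
         (AE \<omega> in P. backward_innovation P X n \<omega> = eval_at_shift w (monic_reversed_gop w \<sigma> n) X \<omega>)"
proof -
  have J: "{..n} - {n} = {..<n}" "{..n} - {0} = {1..n}" by auto
  have "bij_betw (\<lambda>j. j) {..n} {..n}"
    by (simp add: bij_betw_def)
  from prediction_gram_schmidt[OF assms this]
  have forward: "AE \<omega> in P. forward_prediction P X n \<omega>
      = X n \<omega> - eval_at_shift w (monic_gop w \<sigma> n) X \<omega>"
    by (simp add: forward_prediction_def monic_gop_def gop_def J)
  have "bij_betw (\<lambda>j. n - j) {..n} {..n}"
    \<comment> \<open>On \<open>{..n}\<close> truncated subtraction from n is its own
      inverse.\<close>
    by (rule bij_betw_byWitness[where f' = "\<lambda>j. n - j"]) auto
  from prediction_gram_schmidt[OF assms this]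
  have backward: "AE \<omega> in P. backward_prediction P X n \<omega>
      = X 0 \<omega> - eval_at_shift w (monic_reversed_gop w \<sigma> n) X \<omega>"
    by (simp add: backward_prediction_def monic_reversed_gop_def reversed_gop_def J)
  have "AE \<omega> in P. forward_innovation P X n \<omega> = eval_at_shift w (monic_gop w \<sigma> n) X \<omega>"
    using forward by eventually_elim (simp add: forward_innovation_def)
  moreover have "AE \<omega> in P. backward_innovation P X n \<omega>
      = eval_at_shift w (monic_reversed_gop w \<sigma> n) X \<omega>"
    using backward by eventually_elim (simp add: backward_innovation_def)
  ultimately show ?thesis
    using forward backward by (simp add: process_shift_pow)
qed

end
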